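(* Let $A,B,C,D\in\mathbb{Z}$ and let $p$ be a prime number with $p\equiv 1\pmod 4$. Let $E$ be the algebraic curve $y^2=Ax^3+Bx^2+Cx+D$. Suppose that $$-3A+C\equiv -1\pmod 4,\qquad A-B+C\equiv -1\pmod 4,\qquad p^2=A-B+C-D.$$ Then $E$ has no positive integer solutions; that is, there are no integers $x\ge 1$, $y\ge 1$ with $y^2=Ax^3+Bx^2+Cx+D$.
   Context: No nonsingularity of the curve is assumed. *)

theory Defs
  imports "HOL-Number_Theory.Number_Theory"
begin

end

theory Submission
  imports Defs
begin

text \<open>
  Write \<open>f x = A x\<^sup>3 + B x\<^sup>2 + C x + D\<close>. The last hypothesis says \<open>f (-1) = - p\<^sup>2\<close>, so a point
  \<open>(x, y)\<close> on the curve gives \<open>y\<^sup>2 + p\<^sup>2 = f x - f (-1) = (x + 1) g(x)\<close> for an explicit quadratic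
  \<open>g\<close>. The two congruences are exactly what makes \<open>g(x) \<equiv> A x (x - 1) - 1\<close> modulo 4. Hence, if
  \<open>x \<equiv> 0\<close> or \<open>x \<equiv> 1\<close>, the cofactor \<open>g(x)\<close> is \<open>3\<close> modulo 4; if \<open>x \<equiv> 2\<close>, the factor \<open>x + 1\<close> is;
  and \<open>x \<equiv> 3\<close> would make the left-hand side, a sum of two squares one of which is odd, divisible
  by 4. For \<open>x \<ge> 1\<close> both factors are positive.

  So \<open>y\<^sup>2 + p\<^sup>2\<close> has a positive divisor that is \<open>3\<close> modulo 4, and therefore a prime divisor \<open>q\<close> of
  that kind (\<open>three_mod_four_prime_divisor\<close>). Since \<open>-1\<close> is not a square modulo \<open>q\<close>, \<open>q\<close> divides
  both \<open>y\<close> and \<open>p\<close> (\<open>three_mod_four_prime_dvd_sum_squares\<close>). As \<open>p\<close> is prime, \<open>q = p\<close>, which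
  contradicts \<open>p \<equiv> 1\<close> modulo 4.
\<close>

text \<open>
  Residues \<open>1\<close> modulo 4 are closed under multiplication, so the odd prime factors cannot all be
  \<open>1\<close> modulo 4.
\<close>
lemma three_mod_four_prime_divisor:
  fixes n :: nat
  assumes "n mod 4 = 3"
  obtains q where "prime q" "q dvd n" "q mod 4 = 3"
proof -
  have "\<exists>q. prime q \<and> q dvd n \<and> q mod 4 = 3"
    using assms
  proof (induction n rule: less_induct)
    case (less n)
    have "n \<noteq> 1" using less.prems by auto
    then obtain r where r: "prime r" "r dvd n"
      using prime_factor_nat by blast
    then obtain m where m: "n = r * m" by (elim dvdE)
    have "odd n" using less.prems by presburger
    then have "odd r" using m by simp
    then have "r mod 4 = 3 \<or> r mod 4 = 1" by presburger
    then consider "r mod 4 = 3" | "r mod 4 = 1" by blast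
    then show ?case
    proof cases
      case 1
      with r show ?thesis by blast
    next
      case 2
      have "n mod 4 = (r mod 4) * m mod 4" using m by (simp add: mod_mult_left_eq)
      then have m3: "m mod 4 = 3" using 2 less.prems by simp
      then have "m > 0" by (intro gr0I) simp
      then have "m < n" using m prime_gt_1_nat[OF r(1)] by simp
      then obtain q where "prime q" "q dvd m" "q mod 4 = 3"
        using less.IH m3 by blast
      then show ?thesis using m by auto
    qed
  qed
  then show thesis using that by blast
qed

text \<open>
  Here \<open>(q - 1) / 2\<close> is odd. If \<open>q\<close> did not divide \<open>b\<close>, raising \<open>a\<^sup>2 \<equiv> - b\<^sup>2\<close> to this power would
  give \<open>1 \<equiv> -1\<close> modulo \<open>q\<close> by Fermat's little theorem.
\<close>
lemma three_mod_four_prime_dvd_sum_squares: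
  fixes q a b :: nat
  assumes q: "prime q" "q mod 4 = 3" and dvd: "q dvd a\<^sup>2 + b\<^sup>2"
  shows "q dvd b"
proof (rule ccontr)
  assume nb: "\<not> q dvd b"
  have na: "\<not> q dvd a"
  proof
    assume "q dvd a"
    then have "q dvd a\<^sup>2" by (simp add: power2_eq_square)
    then have "q dvd b\<^sup>2" using dvd by (simp add: dvd_add_right_iff)
    then show False using nb q(1) prime_dvd_power by blast
  qed
  have "\<exists>m. odd m \<and> q - 1 = 2 * m"
    using q(2) by presburger
  then obtain m where m: "odd m" "q - 1 = 2 * m" by blast
  have fermat: "[int c ^ (2 * m) = 1] (mod int q)" if "\<not> q dvd c" for c
    using fermat_theorem[OF q(1) that] unfolding m(2)
    by (metis cong_int_iff of_nat_1 of_nat_power)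
  have "int q dvd int (a\<^sup>2 + b\<^sup>2)" using dvd by (simp only: of_nat_dvd_iff)
  then have "[(int a)\<^sup>2 = - (int b)\<^sup>2] (mod int q)"
    by (simp add: cong_iff_dvd_diff)
  then have "[((int a)\<^sup>2) ^ m = (- (int b)\<^sup>2) ^ m] (mod int q)"
    by (rule cong_pow)
  then have "[int a ^ (2 * m) = - (int b ^ (2 * m))] (mod int q)"
    using m(1) by (simp add: power_mult)
  moreover have "[- (int b ^ (2 * m)) = - 1] (mod int q)"
    using fermat[OF nb] by (simp only: cong_minus_minus_iff)
  ultimately have "[1 = - 1] (mod int q)"
    using fermat[OF na] by (meson cong_sym cong_trans)
  then have "int q dvd int 2" by (simp add: cong_iff_dvd_diff)
  then have "q dvd 2" by (simp only: of_nat_dvd_iff)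
  then have "q \<le> 2" by (rule dvd_imp_le) simp
  then show False using q(2) by (cases "q = 0 \<or> q = 1 \<or> q = 2") auto
qed

theorem lemma2:
  fixes A B C D :: int and p :: nat
  assumes "prime p" and "[p = 1] (mod 4)"
    and "[- 3 * A + C = - 1] (mod 4)"
    and "[A - B + C = - 1] (mod 4)"
    and "(int p)^2 = A - B + C - D"
  shows "\<not> (\<exists>x y :: int. x \<ge> 1 \<and> y \<ge> 1 \<and> y^2 = A * x^3 + B * x^2 + C * x + D)"
proof
  assume "\<exists>x y :: int. x \<ge> 1 \<and> y \<ge> 1 \<and> y^2 = A * x^3 + B * x^2 + C * x + D"
  then obtain x y :: int where x: "x \<ge> 1" and y: "y \<ge> 1"
    and curve: "y^2 = A * x^3 + B * x^2 + C * x + D" by blast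
  define g where "g = A * x\<^sup>2 + (B - A) * x + (A - B + C)"
  have factor: "y\<^sup>2 + (int p)\<^sup>2 = (x + 1) * g"
    unfolding curve assms(5) g_def
    by (simp add: algebra_simps power2_eq_square power3_eq_cube)
  have p4: "p mod 4 = 1" using assms(2) by (simp add: cong_def)
  have "g > 0"
  proof -
    have "(x + 1) * g > 0"
      unfolding factor[symmetric] using y by (intro add_pos_nonneg) auto
    then show ?thesis using x by (simp add: zero_less_mult_iff)
  qed

  \<comment> \<open>The hypotheses give \<open>B - A \<equiv> C + 1 \<equiv> 3 A \<equiv> - A\<close> for the linear coefficient of \<open>g\<close>.\<close>
  obtain s where s: "- 3 * A + C = - 1 + 4 * s"
    using assms(3) by (metis cong_iff_lin cong_sym)
  obtain t where t: "A - B + C = - 1 + 4 * t"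
    using assms(4) by (metis cong_iff_lin cong_sym)
  have C: "C = 3 * A - 1 + 4 * s" and B: "B = 4 * A + 4 * s - 4 * t" using s t by auto
  have g: "g = A * (x * (x - 1)) - 1 + 4 * (A * x + s * x - t * x + t)"
    unfolding g_def B C by (simp add: algebra_simps power2_eq_square)

  have "\<exists>d. d > 0 \<and> d dvd y\<^sup>2 + (int p)\<^sup>2 \<and> d mod 4 = 3"
  proof -
    have "x mod 4 = 0 \<or> x mod 4 = 1 \<or> x mod 4 = 2 \<or> x mod 4 = 3" by presburger
    then consider "x mod 4 = 0 \<or> x mod 4 = 1" | "x mod 4 = 2" | "x mod 4 = 3" by blast
    then show ?thesis
    proof cases
      case 1
      then have "4 dvd x \<or> 4 dvd x - 1" by presburger
      then have "4 dvd A * (x * (x - 1))" by (auto intro: dvd_mult dvd_mult2)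
      then have "g mod 4 = 3" unfolding g by presburger
      then show ?thesis using \<open>g > 0\<close> factor by auto
    next
      case 2
      then have "(x + 1) mod 4 = 3" by presburger
      then show ?thesis using x factor by (intro exI[of _ "x + 1"]) auto
    next
      case 3
      then have "4 dvd x + 1" by presburger
      then have dvd4: "4 dvd y\<^sup>2 + (int p)\<^sup>2" unfolding factor by simp
      have square: "c\<^sup>2 mod 4 = c mod 2" for c :: int
      proof (cases "even c")
        case True
        then show ?thesis by (auto elim!: evenE)
      next
        case False
        then obtain k where "c = 2 * k + 1" by (elim oddE)
        then have "c\<^sup>2 = 4 * (k\<^sup>2 + k) + 1" "c mod 2 = 1"
          by (simp_all add: power2_eq_square algebra_simps)
        then show ?thesis by presburger
      qed
      have "odd p" using p4 by presburger
      then have "int p mod 2 = 1" by presburger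
      then have "(int p)\<^sup>2 mod 4 = 1" using square by simp
      moreover have "y\<^sup>2 mod 4 = 0 \<or> y\<^sup>2 mod 4 = 1" using square[of y] by presburger
      ultimately have False using dvd4 by presburger
      then show ?thesis ..
    qed
  qed
  then obtain d where d: "d > 0" "d dvd y\<^sup>2 + (int p)\<^sup>2" "d mod 4 = 3" by blast
  obtain n where n: "d = int n" using d(1) pos_int_cases by blast
  have "n mod 4 = 3" using d(3) unfolding n by presburger
  then obtain q where q: "prime q" "q dvd n" "q mod 4 = 3"
    by (rule three_mod_four_prime_divisor)
  have "int q dvd d" using q(2) n by simp
  then have "int q dvd int ((nat y)\<^sup>2 + p\<^sup>2)" using d(2) y by (auto intro: dvd_trans)
  then have "q dvd (nat y)\<^sup>2 + p\<^sup>2" by (simp only: of_nat_dvd_iff)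
  then have "q dvd p"
    using three_mod_four_prime_dvd_sum_squares q by blast
  then have "q = p" using q(1) assms(1) by (simp add: primes_dvd_imp_eq)
  then show False using q(3) p4 by simp
qed

end
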